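(* Suppose there exists $x'\in[K]$ such that for any $x\in[K]$, any $t,M\in\mathbb N$ and $z\in[K]^t$, $$I_x+\sum_{s=1}^M\omega\big(\pi_{t+s}(z,x,x',\dots,x')\big)\le I_{x'}+\sum_{s=1}^M\omega\big(\pi_{t+s}(z,x',x',\dots,x')\big).$$ Then: (i) for any $t,M\in\mathbb N$, $z\in[K]^t$ and $(x_{t+1},\dots,x_{t+M})\in[K]^M$, $$\sum_{s=1}^M\big(I_{x_{t+s}}+\omega(\pi_{t+s}(z,x_{t+1},\dots,x_{t+s}))\big)\le\sum_{s=1}^M\big(I_{x'}+\omega(\pi_{t+s}(z,x',\dots,x'))\big);$$ (ii) for any $t\in\mathbb N$ and $z\in[K]^t$, the constant sequence $(x',x',\dots)$ solves $$\sup_{(x_{t+1},x_{t+2},\dots)\in[K]^\infty}\ \liminf_{M\to\infty}\frac1M\sum_{s=1}^M\big(I_{x_{t+s}}+\omega(\pi_{t+s}(z,x_{t+1},\dots,x_{t+s}))\big);$$ (iii) the block of length one $\Xi_2=(x')$ maximizes $\mathsf D(\Xi)$ over all blocks $\Xi\in[K]^\ell$, $\ell\in\mathbb N$.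
   Context: Fix $K\ge2$, $[K]=\{1,\dots,K\}$, $\mathbb N=\{1,2,\dots\}$. The change-point model is given by functions $\pi_t:[K]^t\to[0,1)$, $t\in\mathbb N$: $\pi_t(x_1,\dots,x_t)$ is the conditional probability that the change occurs at time $t$, given that it has not occurred before and that the first $t$ treatments are $x_1,\dots,x_t$. In $\pi_{t+s}(z,\cdot)$ the first $t$ treatments are $z$ and the remaining $s$ are as listed. $I_x\in(0,\infty)$ is the Kullback-Leibler divergence $\int\log(g_x/f_x)g_x\,d\mu$ between the post-change and pre-change response densities under treatment $x\in[K]$. $\omega(x)=|\log(1-x)|$. A block is $\Xi\in[K]^\ell$, extended cyclically ($\Xi(m\ell+i)=\Xi(i)$), $\Xi(i:j)=(\Xi(i),\dots,\Xi(j))$. Standing assumption: for each block $\Xi\in[K]^\ell$ there is $d(\Xi)\ge0$ with $\lim_{M\to\infty}\frac1M\sum_{s=1}^M\omega(\pi_{t+s}(z,\Xi(j:s+j-1)))=d(\Xi)$, uniformly in $t\ge0$, $z\in[K]^t$, $j\in\{1,\dots,\ell\}$. $\mathsf D(\Xi)=\frac1\ell\sum_{i=1}^\ell I_{\Xi(i)}+d(\Xi)$. *)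

theory Defs
  imports "HOL-Probability.Probability"
begin

text \<open>
  Treatments are the naturals \<open>1, \<dots>, K\<close> and treatment strings are lists. The functions
  \<open>\<pi>\<^sub>t\<close>, for all \<open>t \<ge> 1\<close>, are packed into one function \<open>\<pi> :: nat list \<Rightarrow> real\<close>: \<open>t\<close> is the length
  of the argument, and the value at the empty list is never constrained.
\<close>

definition words :: "nat \<Rightarrow> nat \<Rightarrow> nat list set" where
  "words K t = {z. length z = t \<and> set z \<subseteq> {1..K}}"

definition omega :: "real \<Rightarrow> real" where
  "omega p = \<bar>ln (1 - p)\<bar>"

definition kl_div :: "'y measure \<Rightarrow> ('y \<Rightarrow> real) \<Rightarrow> ('y \<Rightarrow> real) \<Rightarrow> real" where
  "kl_div \<mu> f g = (\<integral>y. ln (g y / f y) * g y \<partial>\<mu>)"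

lemma kl_div_eq_KL_divergence:
  assumes "sigma_finite_measure \<mu>"
    and "f \<in> borel_measurable \<mu>" "AE y in \<mu>. 0 \<le> f y"
    and "g \<in> borel_measurable \<mu>" "AE y in \<mu>. 0 \<le> g y"
    and "AE y in \<mu>. f y = 0 \<longrightarrow> g y = 0"
  shows "kl_div \<mu> f g = KL_divergence (exp 1) (density \<mu> f) (density \<mu> g)"
proof -
  interpret sigma_finite_measure \<mu> by fact
  show ?thesis
    using KL_density_density[of "exp 1" f g] assms
    by (simp add: kl_div_def log_def mult.commute)
qed

text \<open>\<open>cyc \<Xi> i\<close> is \<open>\<Xi>(i)\<close> for \<open>i \<ge> 1\<close>, with one-based indices, and \<open>segment \<Xi> i j\<close> is \<open>\<Xi>(i:j)\<close>.\<close>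

definition cyc :: "nat list \<Rightarrow> nat \<Rightarrow> nat" where
  "cyc \<Xi> i = \<Xi> ! ((i - 1) mod length \<Xi>)"

definition segment :: "nat list \<Rightarrow> nat \<Rightarrow> nat \<Rightarrow> nat list" where
  "segment \<Xi> i j = map (cyc \<Xi>) [i..<Suc j]"

text \<open>
  \<open>f x\<close> and \<open>g x\<close> are the pre-change and post-change response densities under treatment \<open>x\<close>.
  Absolute continuity and integrability together express that the divergence is finite; without
  them the integral in \<open>kl_div\<close> could be an arbitrary default value.
  The limit \<open>d \<Xi>\<close> is unique, so fixing it as a parameter amounts to assuming that it exists.
\<close>

locale change_point_model =
  fixes K :: nat
    and \<mu> :: "'y measure"
    and f g :: "nat \<Rightarrow> 'y \<Rightarrow> real"
    and I :: "nat \<Rightarrow> real"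
    and \<pi> :: "nat list \<Rightarrow> real"
    and d :: "nat list \<Rightarrow> real"
  assumes K_ge_2: "K \<ge> 2"
    and pre_density:
      "x \<in> {1..K} \<Longrightarrow> f x \<in> borel_measurable \<mu>"
      "x \<in> {1..K} \<Longrightarrow> y \<in> space \<mu> \<Longrightarrow> 0 \<le> f x y"
      "x \<in> {1..K} \<Longrightarrow> (\<integral>\<^sup>+ y. ennreal (f x y) \<partial>\<mu>) = 1"
    and post_density:
      "x \<in> {1..K} \<Longrightarrow> g x \<in> borel_measurable \<mu>"
      "x \<in> {1..K} \<Longrightarrow> y \<in> space \<mu> \<Longrightarrow> 0 \<le> g x y"
      "x \<in> {1..K} \<Longrightarrow> (\<integral>\<^sup>+ y. ennreal (g x y) \<partial>\<mu>) = 1"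
    and kl_finite:
      "x \<in> {1..K} \<Longrightarrow> AE y in \<mu>. f x y = 0 \<longrightarrow> g x y = 0"
      "x \<in> {1..K} \<Longrightarrow> integrable \<mu> (\<lambda>y. ln (g x y / f x y) * g x y)"
    and I_eq: "x \<in> {1..K} \<Longrightarrow> I x = kl_div \<mu> (f x) (g x)"
    and I_pos: "x \<in> {1..K} \<Longrightarrow> 0 < I x"
    and hazard_range: "t \<ge> 1 \<Longrightarrow> z \<in> words K t \<Longrightarrow> \<pi> z \<in> {0..<1}"
    and d_nonneg: "l \<ge> 1 \<Longrightarrow> \<Xi> \<in> words K l \<Longrightarrow> 0 \<le> d \<Xi>"
    and d_limit: "l \<ge> 1 \<Longrightarrow> \<Xi> \<in> words K l \<Longrightarrow>
      uniform_limit ((\<Union>t. words K t) \<times> {1..l})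
        (\<lambda>M (z, j). 1 / real M * (\<Sum>s = 1..M. omega (\<pi> (z @ segment \<Xi> j (s + j - 1)))))
        (\<lambda>_. d \<Xi>) sequentially"

definition block_D :: "(nat \<Rightarrow> real) \<Rightarrow> (nat list \<Rightarrow> real) \<Rightarrow> nat list \<Rightarrow> real" where
  "block_D I d \<Xi> = 1 / real (length \<Xi>) * (\<Sum>i = 1..length \<Xi>. I (cyc \<Xi> i)) + d \<Xi>"

text \<open>
  An infinite continuation is a function \<open>x\<close> with \<open>x s\<close> the treatment at time \<open>t + s\<close>, \<open>s \<ge> 1\<close>,
  where \<open>t\<close> is the length of the past \<open>z\<close>; \<open>x 0\<close> is never used. The limit inferior is taken in
  the extended reals.
\<close>

definition continuations :: "nat \<Rightarrow> (nat \<Rightarrow> nat) set" where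
  "continuations K = {x. \<forall>s\<ge>1. x s \<in> {1..K}}"

definition long_run_reward ::
    "(nat \<Rightarrow> real) \<Rightarrow> (nat list \<Rightarrow> real) \<Rightarrow> nat list \<Rightarrow> (nat \<Rightarrow> nat) \<Rightarrow> ereal" where
  "long_run_reward I \<pi> z x =
     liminf (\<lambda>M. ereal (1 / real M *
       (\<Sum>s = 1..M. I (x s) + omega (\<pi> (z @ map x [1..<Suc s])))))"

end

theory Submission
  imports Defs
begin

text \<open>
  Replace the treatments by \<open>x'\<close> one at a time, starting from the last one: the hypothesis says that
  a replacement followed only by \<open>x'\<close> does not lower the finite-horizon sum. The other two claims
  follow by dividing by \<open>M\<close> and letting \<open>M \<rightarrow> \<infinity>\<close>, for blocks of length \<open>\<ell>\<close> along the multiples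
  of \<open>\<ell>\<close>.
\<close>

lemma sum_replace_by_constant_le:
  fixes I :: "nat \<Rightarrow> real" and \<phi> :: "nat list \<Rightarrow> real"
  assumes a: "a \<in> {1..K}"
    and dominance: "\<And>x t M z. x \<in> {1..K} \<Longrightarrow> t \<ge> 1 \<Longrightarrow> M \<ge> 1 \<Longrightarrow> z \<in> words K t \<Longrightarrow>
      I x + (\<Sum>s = 1..M. \<phi> (z @ x # replicate (s - 1) a))
        \<le> I a + (\<Sum>s = 1..M. \<phi> (z @ a # replicate (s - 1) a))"
    and "t \<ge> 1" "z \<in> words K t" "xs \<in> words K M"
  shows "(\<Sum>s = 1..M. I (xs ! (s - 1)) + \<phi> (z @ take s xs))
    \<le> (\<Sum>s = 1..M. I a + \<phi> (z @ replicate s a))"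
  using assms(3-5)
proof (induction xs arbitrary: z t M)
  case Nil
  then show ?case by (simp add: words_def)
next
  case (Cons x ys)
  obtain N where M: "M = Suc N" and ys: "ys \<in> words K N" and x: "x \<in> {1..K}"
    using Cons.prems(3) by (auto simp: words_def)
  have zx: "z @ [x] \<in> words K (Suc t)"
    using Cons.prems(2) x by (auto simp: words_def)
  have IH: "(\<Sum>s<N. I (ys ! s) + \<phi> (z @ x # take (Suc s) ys))
      \<le> (\<Sum>s<N. I a + \<phi> (z @ x # replicate (Suc s) a))"
    using Cons.IH[OF _ zx ys] by (simp add: sum.atLeast1_atMost_eq)
  have dom: "I x + (\<Sum>s<Suc N. \<phi> (z @ x # replicate s a))
      \<le> I a + (\<Sum>s<Suc N. \<phi> (z @ replicate (Suc s) a))"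
    using dominance[OF x Cons.prems(1) _ Cons.prems(2), of M]
    by (simp add: M sum.atLeast1_atMost_eq)
  have "(\<Sum>s = 1..M. I ((x # ys) ! (s - 1)) + \<phi> (z @ take s (x # ys)))
      = I x + \<phi> (z @ [x]) + (\<Sum>s<N. I (ys ! s) + \<phi> (z @ x # take (Suc s) ys))"
    unfolding M One_nat_def sum.atLeast1_atMost_eq sum.lessThan_Suc_shift by simp
  also have "\<dots> \<le> I x + \<phi> (z @ [x]) + (\<Sum>s<N. I a + \<phi> (z @ x # replicate (Suc s) a))"
    using IH by simp
  also have "\<dots> = real N * I a + (I x + (\<Sum>s<Suc N. \<phi> (z @ x # replicate s a)))"
    unfolding sum.distrib sum.lessThan_Suc_shift by simp
  also have "\<dots> \<le> real N * I a + (I a + (\<Sum>s<Suc N. \<phi> (z @ replicate (Suc s) a)))"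
    using dom by simp
  also have "\<dots> = (\<Sum>s = 1..M. I a + \<phi> (z @ replicate s a))"
    unfolding M One_nat_def sum.atLeast1_atMost_eq sum.distrib by (simp add: distrib_right)
  finally show ?case .
qed

lemma map_upt_const: "map (\<lambda>_. a) [1..<Suc s] = replicate s a"
  by (simp add: map_replicate_const)

lemma map_in_words:
  assumes "x \<in> continuations K"
  shows "map x [1..<Suc M] \<in> words K M"
proof -
  have "x s \<in> {1..K}" if "s \<in> set [1..<Suc M]" for s
    using assms that unfolding continuations_def set_upt by simp
  then show ?thesis
    unfolding words_def by (simp add: image_subset_iff del: upt_Suc)
qed

lemma cyc_in_continuations:
  assumes "l \<ge> 1" "\<Xi> \<in> words K l"
  shows "cyc \<Xi> \<in> continuations K"
  unfolding continuations_def cyc_def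
proof (intro CollectI allI impI)
  fix s :: nat
  have "(s - 1) mod length \<Xi> < length \<Xi>"
    using assms by (simp add: words_def)
  then show "\<Xi> ! ((s - 1) mod length \<Xi>) \<in> {1..K}"
    using assms(2) nth_mem unfolding words_def by blast
qed

lemma sum_cyc_multiple:
  fixes I :: "nat \<Rightarrow> real"
  shows "(\<Sum>s = 1..n * length \<Xi>. I (cyc \<Xi> s)) = real n * (\<Sum>i = 1..length \<Xi>. I (cyc \<Xi> i))"
proof -
  let ?l = "length \<Xi>"
  have "(\<Sum>s<n * ?l. I (\<Xi> ! (s mod ?l))) = (\<Sum>m<n. \<Sum>s = m * ?l..<m * ?l + ?l. I (\<Xi> ! (s mod ?l)))"
    by (rule sum.nat_group[symmetric])
  also have "\<dots> = (\<Sum>m<n. \<Sum>i<?l. I (\<Xi> ! (i mod ?l)))"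
  proof (rule sum.cong[OF refl])
    fix m
    show "(\<Sum>s = m * ?l..<m * ?l + ?l. I (\<Xi> ! (s mod ?l))) = (\<Sum>i<?l. I (\<Xi> ! (i mod ?l)))"
      using sum.shift_bounds_nat_ivl[of "\<lambda>s. I (\<Xi> ! (s mod ?l))" 0 "m * ?l" ?l]
      by (simp add: lessThan_atLeast0 add.commute)
  qed
  finally show ?thesis
    by (simp add: cyc_def sum.atLeast1_atMost_eq)
qed

context change_point_model
begin

lemma average_reward_tendsto_block_D:
  assumes l: "l \<ge> 1" and \<Xi>: "\<Xi> \<in> words K l" and z: "z \<in> words K t"
  shows "(\<lambda>n. 1 / real (n * l) *
      (\<Sum>s = 1..n * l. I (cyc \<Xi> s) + omega (\<pi> (z @ map (cyc \<Xi>) [1..<Suc s]))))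
    \<longlonglongrightarrow> block_D I d \<Xi>"
proof -
  let ?S = "\<lambda>M. \<Sum>s = 1..M. omega (\<pi> (z @ map (cyc \<Xi>) [1..<Suc s]))"
  have len: "length \<Xi> = l"
    using \<Xi> by (simp add: words_def)
  have "(z, 1) \<in> (\<Union>t. words K t) \<times> {1..l}"
    using z l by auto
  from tendsto_uniform_limitI[OF d_limit[OF l \<Xi>] this]
  have "(\<lambda>M. 1 / real M * ?S M) \<longlonglongrightarrow> d \<Xi>"
    by (simp add: segment_def del: upt_Suc)
  then have "((\<lambda>M. 1 / real M * ?S M) \<circ> (\<lambda>n. n * l)) \<longlonglongrightarrow> d \<Xi>"
    using l by (intro LIMSEQ_subseq_LIMSEQ) (auto simp: strict_mono_def)
  then have lim: "(\<lambda>n. 1 / real l * (\<Sum>i = 1..l. I (cyc \<Xi> i)) + 1 / real (n * l) * ?S (n * l))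
      \<longlonglongrightarrow> block_D I d \<Xi>"
    unfolding block_D_def len o_def by (intro tendsto_add tendsto_const)
  show ?thesis
  proof (rule Lim_transform_eventually[OF lim])
    show "\<forall>\<^sub>F n in sequentially.
        1 / real l * (\<Sum>i = 1..l. I (cyc \<Xi> i)) + 1 / real (n * l) * ?S (n * l)
        = 1 / real (n * l) *
          (\<Sum>s = 1..n * l. I (cyc \<Xi> s) + omega (\<pi> (z @ map (cyc \<Xi>) [1..<Suc s])))"
      using eventually_gt_at_top[of 0]
    proof eventually_elim
      case (elim n)
      show ?case
        using elim l sum_cyc_multiple[where I = I and n = n and \<Xi> = \<Xi>]
        by (simp add: len sum.distrib distrib_left del: upt_Suc)
    qed
  qed
qed

end

theorem lemmaF2:
  fixes K :: nat
    and \<mu> :: "'y measure"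
    and f g :: "nat \<Rightarrow> 'y \<Rightarrow> real"
    and I :: "nat \<Rightarrow> real"
    and \<pi> :: "nat list \<Rightarrow> real"
    and d :: "nat list \<Rightarrow> real"
    and x' :: nat
  assumes model: "change_point_model K \<mu> f g I \<pi> d"
    and x': "x' \<in> {1..K}"
    and dominance: "\<And>x t M z. x \<in> {1..K} \<Longrightarrow> t \<ge> 1 \<Longrightarrow> M \<ge> 1 \<Longrightarrow> z \<in> words K t \<Longrightarrow>
      I x + (\<Sum>s = 1..M. omega (\<pi> (z @ x # replicate (s - 1) x')))
        \<le> I x' + (\<Sum>s = 1..M. omega (\<pi> (z @ x' # replicate (s - 1) x')))"
  shows "(\<forall>t\<ge>1. \<forall>M\<ge>1. \<forall>z\<in>words K t. \<forall>xs\<in>words K M.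
            (\<Sum>s = 1..M. I (xs ! (s - 1)) + omega (\<pi> (z @ take s xs)))
              \<le> (\<Sum>s = 1..M. I x' + omega (\<pi> (z @ replicate s x'))))
       \<and> (\<forall>t\<ge>1. \<forall>z\<in>words K t.
            long_run_reward I \<pi> z (\<lambda>_. x') = (SUP x\<in>continuations K. long_run_reward I \<pi> z x))
       \<and> (\<forall>l\<ge>1. \<forall>\<Xi>\<in>words K l. block_D I d \<Xi> \<le> block_D I d [x'])"
proof -
  interpret change_point_model K \<mu> f g I \<pi> d by (rule model)
  have finite_horizon: "(\<Sum>s = 1..M. I (xs ! (s - 1)) + omega (\<pi> (z @ take s xs)))
      \<le> (\<Sum>s = 1..M. I x' + omega (\<pi> (z @ replicate s x')))"
    if "t \<ge> 1" "z \<in> words K t" "xs \<in> words K M" for t M z xs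
    using sum_replace_by_constant_le[where \<phi> = "\<lambda>w. omega (\<pi> w)", OF x' dominance that] .
  have continuation: "(\<Sum>s = 1..M. I (x s) + omega (\<pi> (z @ map x [1..<Suc s])))
      \<le> (\<Sum>s = 1..M. I x' + omega (\<pi> (z @ replicate s x')))"
    if "t \<ge> 1" "z \<in> words K t" "x \<in> continuations K" for t M z x
  proof -
    have "(\<Sum>s = 1..M. I (x s) + omega (\<pi> (z @ map x [1..<Suc s])))
        = (\<Sum>s = 1..M. I (map x [1..<Suc M] ! (s - 1))
            + omega (\<pi> (z @ take s (map x [1..<Suc M]))))"
      by (rule sum.cong) (auto simp: take_map nth_append simp del: upt_Suc)
    then show ?thesis
      using finite_horizon[OF that(1,2) map_in_words[OF that(3)], of M] by simp
  qed
  have "long_run_reward I \<pi> z (\<lambda>_. x') = (SUP x\<in>continuations K. long_run_reward I \<pi> z x)"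
    if "t \<ge> 1" "z \<in> words K t" for t z
  proof (rule antisym)
    show "long_run_reward I \<pi> z (\<lambda>_. x') \<le> (SUP x\<in>continuations K. long_run_reward I \<pi> z x)"
      using x' by (intro SUP_upper) (auto simp: continuations_def)
    show "(SUP x\<in>continuations K. long_run_reward I \<pi> z x) \<le> long_run_reward I \<pi> z (\<lambda>_. x')"
      unfolding long_run_reward_def map_upt_const
      by (intro SUP_least Liminf_mono always_eventually allI ereal_less_eq(3)[THEN iffD2]
          mult_left_mono continuation[OF that]) simp_all
  qed
  moreover have "block_D I d \<Xi> \<le> block_D I d [x']" if l: "l \<ge> 1" and \<Xi>: "\<Xi> \<in> words K l" for l \<Xi>
  proof -
    have z: "[x'] \<in> words K 1"
      using x' by (simp add: words_def)
    have const: "cyc [x'] = (\<lambda>_. x')"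
      by (simp add: cyc_def fun_eq_iff)
    have "strict_mono (\<lambda>n. n * l)"
      using l by (simp add: strict_mono_def)
    from LIMSEQ_subseq_LIMSEQ[OF average_reward_tendsto_block_D[OF order_refl z z] this]
    have "(\<lambda>n. 1 / real (n * l) *
        (\<Sum>s = 1..n * l. I x' + omega (\<pi> ([x'] @ replicate s x')))) \<longlonglongrightarrow> block_D I d [x']"
      unfolding const map_upt_const o_def mult_1_right .
    moreover have "1 / real (n * l) *
        (\<Sum>s = 1..n * l. I (cyc \<Xi> s) + omega (\<pi> ([x'] @ map (cyc \<Xi>) [1..<Suc s])))
        \<le> 1 / real (n * l) *
        (\<Sum>s = 1..n * l. I x' + omega (\<pi> ([x'] @ replicate s x')))" for n
      by (rule mult_left_mono[OF continuation[OF order_refl z cyc_in_continuations[OF l \<Xi>]]]) simp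
    ultimately show ?thesis
      using LIMSEQ_le[OF average_reward_tendsto_block_D[OF l \<Xi> z]] by meson
  qed
  ultimately show ?thesis
    using finite_horizon by simp
qed

end
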